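(* Let $S_k^p$ be a generalized sunlet graph. If $k$ is odd and $p$ is even, then $S_k^p$ has a canonical ESD labeling.
   Context: For $k\ge 3$ and $p\ge 1$, the generalized sunlet graph $S_k^p$ is the unicyclic graph obtained from a cycle $C_k$ with vertices $c_1,\dots,c_k$ by attaching, for each $i\in\{1,\dots,k\}$, a path $R_i$ on $p$ vertices so that one endpoint of $R_i$ is identified with $c_i$ (the paths are otherwise disjoint). For a graph $G=(V,E)$ and $l\in\mathbb N$, a vertex labeling $\phi:V\to\{1,\dots,l\}$ is an edge-sum distinguishing (ESD) labeling if $\phi$ is injective and the edge-weights $w_\phi(uv)=\phi(u)+\phi(v)$ are pairwise distinct over all edges $uv\in E$. It is a canonical ESD labeling if $l=|V|$. *)

theory Defs
  imports Main
begin

text \<open>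
  A finite simple graph is given by its vertex set \<open>V\<close> and its set \<open>E\<close> of edges, each edge
  being the two-element set of its end vertices.
\<close>

definition simple_graph :: "'a set \<Rightarrow> 'a set set \<Rightarrow> bool" where
  "simple_graph V E \<longleftrightarrow> finite V \<and> (\<forall>e\<in>E. e \<subseteq> V \<and> card e = 2)"

text \<open>
  The vertex \<open>(i, j)\<close> is the \<open>j\<close>-th vertex of the path \<open>R\<^sub>i\<close>, counted from 0 starting at the end
  that is identified with the cycle vertex; so \<open>(i, 0)\<close> is a cycle vertex. The index \<open>i\<close> of
  cycle vertices runs over \<open>0, \<dots>, k - 1\<close> and is cyclic modulo \<open>k\<close>.
\<close>

definition sunlet_verts :: "nat \<Rightarrow> nat \<Rightarrow> (nat \<times> nat) set" where
  "sunlet_verts k p = {0..<k} \<times> {0..<p}"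

definition sunlet_edges :: "nat \<Rightarrow> nat \<Rightarrow> (nat \<times> nat) set set" where
  "sunlet_edges k p =
     {{(i, 0), (Suc i mod k, 0)} | i. i < k} \<union>
     {{(i, j), (i, Suc j)} | i j. i < k \<and> Suc j < p}"

text \<open>For an edge \<open>{u, v}\<close> with \<open>u \<noteq> v\<close> this is \<open>\<phi> u + \<phi> v\<close>.\<close>

definition edge_weight :: "('a \<Rightarrow> nat) \<Rightarrow> 'a set \<Rightarrow> nat" where
  "edge_weight \<phi> e = (\<Sum>v\<in>e. \<phi> v)"

definition ESD_labeling :: "'a set \<Rightarrow> 'a set set \<Rightarrow> nat \<Rightarrow> ('a \<Rightarrow> nat) \<Rightarrow> bool" where
  "ESD_labeling V E l \<phi> \<longleftrightarrow>
     \<phi> ` V \<subseteq> {1..l} \<and> inj_on \<phi> V \<and> inj_on (edge_weight \<phi>) E"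

definition canonical_ESD_labeling :: "'a set \<Rightarrow> 'a set set \<Rightarrow> ('a \<Rightarrow> nat) \<Rightarrow> bool" where
  "canonical_ESD_labeling V E \<phi> \<longleftrightarrow> ESD_labeling V E (card V) \<phi>"

lemma edge_weight_doubleton: "u \<noteq> v \<Longrightarrow> edge_weight \<phi> {u, v} = \<phi> u + \<phi> v"
  by (simp add: edge_weight_def)

lemma card_sunlet_verts: "card (sunlet_verts k p) = k * p"
  by (simp add: sunlet_verts_def)

lemma Suc_mod_neq:
  assumes "3 \<le> k" "i < k"
  shows "Suc i mod k \<noteq> i"
  using assms by (cases "Suc i = k") auto

lemma simple_graph_sunlet:
  assumes "3 \<le> k" "1 \<le> p"
  shows "simple_graph (sunlet_verts k p) (sunlet_edges k p)"
proof -
  have "e \<subseteq> sunlet_verts k p \<and> card e = 2" if "e \<in> sunlet_edges k p" for e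
    using that unfolding sunlet_edges_def
  proof (elim UnE CollectE exE conjE)
    fix i assume i: "e = {(i, 0), (Suc i mod k, 0)}" "i < k"
    have "Suc i mod k < k" using assms by simp
    moreover have "i \<noteq> Suc i mod k" using Suc_mod_neq[OF assms(1) i(2)] by simp
    ultimately show ?thesis using i assms by (simp add: sunlet_verts_def)
  next
    fix i j assume "e = {(i, j), (i, Suc j)}" "i < k" "Suc j < p"
    then show ?thesis by (simp add: sunlet_verts_def)
  qed
  then show ?thesis by (simp add: simple_graph_def sunlet_verts_def)
qed

end

(* Layer j (the j-th vertices of the k paths) receives the labels kj + 1, ..., kj + k, arranged by a
   permutation a of {0..<k} that is rotated by one step in the odd layers. The permutation is chosen
   so that the sums a(i) + a(i+1) are k consecutive numbers. Both the cycle edges and the edges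
   between layers j and j + 1 then see exactly these sums, shifted by multiples 0 and 2j + 1 of k,
   so the weights fill disjoint intervals of length k. *)

theory Submission
  imports Defs
begin

text \<open>For odd \<open>k\<close> this is \<open>i / 2\<close> modulo \<open>k\<close>.\<close>

definition half_mod :: "nat \<Rightarrow> nat \<Rightarrow> nat" where
  "half_mod k i = (if even i then i div 2 else (k + i) div 2)"

definition sunlet_label :: "nat \<Rightarrow> nat \<times> nat \<Rightarrow> nat" where
  "sunlet_label k = (\<lambda>(i, j). k * j + half_mod k (if even j then i else Suc i mod k) + 1)"

lemma double_half_mod: "odd k \<Longrightarrow> 2 * half_mod k i = (if even i then i else k + i)"
  by (simp add: half_mod_def)

lemma half_mod_less:
  assumes "odd k" "i < k"
  shows "half_mod k i < k"
  using double_half_mod[OF assms(1), of i] assms(2) by (simp split: if_splits)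

text \<open>Doubling returns the argument up to a summand \<open>k\<close>, and two numbers below
  \<open>k\<close> cannot differ by \<open>k\<close>.\<close>

lemma inj_on_half_mod:
  assumes "odd k"
  shows "inj_on (half_mod k) {0..<k}"
proof (rule inj_onI)
  fix x y assume less: "x \<in> {0..<k}" "y \<in> {0..<k}" and "half_mod k x = half_mod k y"
  then have "(if even x then x else k + x) = (if even y then y else k + y)"
    using double_half_mod[OF assms, of x] double_half_mod[OF assms, of y] by simp
  then show "x = y"
    using less by (simp split: if_splits)
qed

lemma half_mod_add_Suc:
  assumes "odd k" "i < k"
  shows "half_mod k i + half_mod k (Suc i mod k) = k div 2 + Suc i mod k"
proof (cases "Suc i = k")
  \<comment> \<open>At the wrap-around \<open>i = k - 1\<close> is even and contributes
    \<open>k div 2\<close>, while its successor 0 contributes 0.\<close>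
  case True
  then show ?thesis using assms by (auto simp: half_mod_def)
next
  case False
  then have mod: "Suc i mod k = Suc i" using assms by simp
  \<comment> \<open>Exactly one of \<open>i\<close> and \<open>Suc i\<close> is odd, so doubling
    brings in \<open>k\<close> exactly once.\<close>
  have "2 * (half_mod k i + half_mod k (Suc i)) = k + 2 * i + 1"
    by (simp add: distrib_left double_half_mod[OF assms(1)])
  also have "\<dots> = 2 * (k div 2 + Suc i)"
    using odd_two_times_div_two_succ[OF assms(1)] by simp
  finally show ?thesis unfolding mod by simp
qed

lemma inj_on_Suc_mod: "inj_on (\<lambda>i. Suc i mod k) {0..<k}"
  by (rule inj_onI) (auto simp: mod_Suc split: if_splits)

text \<open>Uniqueness of quotient and remainder. It splits a label into layer and position, and
  later a shifted weight into block and position.\<close>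

lemma mult_add_less_eqD:
  fixes k :: nat
  assumes "k * m + r = k * m' + r'" "r < k" "r' < k"
  shows "m = m' \<and> r = r'"
proof -
  have "(k * m + r) div k = m" "(k * m' + r') div k = m'" using assms(2,3) by simp_all
  then show ?thesis using assms(1) by simp
qed

lemma inj_on_sunlet_label:
  assumes "odd k"
  shows "inj_on (sunlet_label k) (sunlet_verts k p)"
proof (rule inj_onI)
  fix u v assume "u \<in> sunlet_verts k p" "v \<in> sunlet_verts k p"
    and eq: "sunlet_label k u = sunlet_label k v"
  then obtain i j i' j' where uv: "u = (i, j)" "v = (i', j')" and less: "i < k" "i' < k"
    by (auto simp: sunlet_verts_def)
  \<comment> \<open>The possibly rotated position within layer \<open>j\<close>. Once the layers
    agree, both sides use the same rotation, which is injective below \<open>k\<close>.\<close>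
  define f where "f l j = (if even j then l else Suc l mod k)" for l j :: nat
  have f: "f i j < k" "f i' j' < k" using less by (auto simp: f_def)
  have "k * j + half_mod k (f i j) = k * j' + half_mod k (f i' j')"
    using eq unfolding uv sunlet_label_def f_def by simp
  then have eqs: "j = j' \<and> half_mod k (f i j) = half_mod k (f i' j')"
    using half_mod_less[OF assms f(1)] half_mod_less[OF assms f(2)] by (rule mult_add_less_eqD)
  then have "f i j = f i' j'"
    using f by (auto intro: inj_onD[OF inj_on_half_mod[OF assms]])
  then have "i = i'"
    using less eqs inj_onD[OF inj_on_Suc_mod[of k], of i i'] by (auto simp: f_def split: if_splits)
  with eqs show "u = v" by (simp add: uv)
qed

lemma sunlet_label_image:
  assumes "odd k"
  shows "sunlet_label k ` sunlet_verts k p \<subseteq> {1..k * p}"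
proof clarify
  fix i j assume "(i, j) \<in> sunlet_verts k p"
  then have i: "i < k" and j: "Suc j \<le> p" by (auto simp: sunlet_verts_def)
  have "half_mod k (if even j then i else Suc i mod k) < k"
    using i by (intro half_mod_less[OF assms]) auto
  moreover have "k * Suc j \<le> k * p" using j by (rule mult_le_mono2)
  ultimately show "sunlet_label k (i, j) \<in> {1..k * p}"
    by (simp add: sunlet_label_def)
qed

lemma edge_weight_cycle:
  assumes "odd k" "3 \<le> k" "i < k"
  shows "edge_weight (sunlet_label k) {(i, 0), (Suc i mod k, 0)} = k div 2 + 2 + Suc i mod k"
proof -
  have "(i, 0) \<noteq> (Suc i mod k, 0)" using Suc_mod_neq[OF assms(2,3)] by simp
  then have "edge_weight (sunlet_label k) {(i, 0), (Suc i mod k, 0)} =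
      sunlet_label k (i, 0) + sunlet_label k (Suc i mod k, 0)"
    by (rule edge_weight_doubleton)
  also have "\<dots> = half_mod k i + half_mod k (Suc i mod k) + 2"
    by (simp add: sunlet_label_def)
  finally show ?thesis by (simp add: half_mod_add_Suc[OF assms(1,3)])
qed

lemma edge_weight_path:
  assumes "odd k" "i < k"
  shows "edge_weight (sunlet_label k) {(i, j), (i, Suc j)} =
    k div 2 + 2 + (k * (2 * j + 1) + Suc i mod k)"
proof -
  have "edge_weight (sunlet_label k) {(i, j), (i, Suc j)} =
      sunlet_label k (i, j) + sunlet_label k (i, Suc j)"
    by (rule edge_weight_doubleton) simp
  also have "\<dots> = k * (2 * j + 1) + (half_mod k i + half_mod k (Suc i mod k)) + 2"
    \<comment> \<open>Exactly one of the layers \<open>j\<close> and \<open>Suc j\<close> is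
      rotated, so in either parity the two \<open>half_mod\<close> terms are those at
      \<open>i\<close> and \<open>Suc i mod k\<close>.\<close>
    by (cases "even j") (simp_all add: sunlet_label_def)
  finally show ?thesis by (simp add: half_mod_add_Suc[OF assms])
qed

lemma inj_on_edge_weight_sunlet_label:
  assumes "odd k" "3 \<le> k"
  shows "inj_on (edge_weight (sunlet_label k)) (sunlet_edges k p)"
proof (rule inj_onI)
  \<comment> \<open>\<open>m\<close> numbers the blocks of weights: 0 for the cycle and
    \<open>2 * j + 1\<close> for the path edges leaving layer \<open>j\<close>, so that
    \<open>m div 2\<close> gives back \<open>j\<close>. As each edge is a function of
    \<open>i\<close> and \<open>m\<close>, it suffices to recover these two from its weight.\<close>
  define edge where "edge i m =
    (if m = 0 then {(i, 0), (Suc i mod k, 0)} else {(i, m div 2), (i, Suc (m div 2))})"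
    for i m :: nat
  have param: "\<exists>i m. e = edge i m \<and> i < k \<and>
      edge_weight (sunlet_label k) e = k div 2 + 2 + (k * m + Suc i mod k)"
    if "e \<in> sunlet_edges k p" for e
    using that unfolding sunlet_edges_def
  proof (elim UnE CollectE exE conjE)
    fix i assume "e = {(i, 0), (Suc i mod k, 0)}" "i < k"
    then show ?thesis
      using edge_weight_cycle[OF assms] by (intro exI[of _ i] exI[of _ 0]) (simp add: edge_def)
  next
    fix i j assume "e = {(i, j), (i, Suc j)}" "i < k"
    then show ?thesis
      using edge_weight_path[OF assms(1)]
      by (intro exI[of _ i] exI[of _ "2 * j + 1"]) (simp add: edge_def)
  qed
  fix e e' assume "e \<in> sunlet_edges k p" "e' \<in> sunlet_edges k p"
    and eq: "edge_weight (sunlet_label k) e = edge_weight (sunlet_label k) e'"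
  then obtain i m i' m' where e: "e = edge i m" "e' = edge i' m'" and less: "i < k" "i' < k"
    and w: "k * m + Suc i mod k = k * m' + Suc i' mod k"
    using param[of e] param[of e'] by auto
  \<comment> \<open>With the common offset \<open>k div 2 + 2\<close> cancelled, the block is the
    quotient by \<open>k\<close> and the rotated index the remainder.\<close>
  have "m = m' \<and> Suc i mod k = Suc i' mod k"
    using w less by (intro mult_add_less_eqD) auto
  then show "e = e'"
    using less inj_onD[OF inj_on_Suc_mod[of k], of i i'] by (simp add: e)
qed

theorem theorem7:
  fixes k p :: nat
  assumes "3 \<le> k" and "1 \<le> p"
    and "odd k" and "even p"
  shows "\<exists>\<phi>. canonical_ESD_labeling (sunlet_verts k p) (sunlet_edges k p) \<phi>"
  using sunlet_label_image[OF assms(3)] inj_on_sunlet_label[OF assms(3)]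
    inj_on_edge_weight_sunlet_label[OF assms(3,1)]
  unfolding canonical_ESD_labeling_def ESD_labeling_def card_sunlet_verts by blast

end
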